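(* Let the training set $\mathcal{D}_{train}$ have the long-tailed label distribution $\mathbb{P}(Y=y_i)=\frac{\lambda}{e^{-\lambda}-e^{-\lambda C}}\,e^{-\lambda y_i}$, $y_i\in[1,C]$, where $\lambda=\frac{\ln\rho}{C-1}$. When the mixing factor is the UniMix Factor $\xi^*_{i,j}\sim\mathscr{U}(\pi_{y_i},\pi_{y_j},\alpha,\alpha)$, $\alpha\in[0,1]$, the newly mixed dataset $\mathcal{D}_\nu$ composed of $\xi$-Aug samples $(\tilde x_{i,j},\tilde y_{i,j})$, where $(x_i,y_i)$ is randomly sampled and $(x_j,y_j)$ is inversely sampled from $\mathcal{D}_{train}$, follows a tail-majority distribution: $$\mathbb{P}_{UniMix}(Y^*=y_i)=\mathbb{P}(Y=y_i)\int_{y_j<y_i}\mathbf{1}\!\left(\int\xi^*_{i,j}\,\mathscr{U}(\pi_{y_i},\pi_{y_j},\alpha,\alpha)\,d\xi^*_{i,j}\ge 0.5\right)\mathbb{P}_{inv}(Y=y_j)\,dy_j$$ $$=\frac{\lambda}{\left(e^{-\lambda}-e^{-\lambda C}\right)\left(e^{-\lambda\tau C}-e^{-\lambda\tau}\right)}\left(e^{-\lambda y_i(\tau+1)}-e^{-\lambda(\tau+y_i)}\right),\qquad y_i\in[1,C].$$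
   Context: $C$ is the number of classes. Classes are indexed in decreasing order of their number of instances, and the class index is treated as a continuous variable in $[1,C]$. $\rho$ is the imbalance factor of the training set: the number of instances of the most frequent class (index $1$) divided by that of the least frequent class (index $C$). $\mathbb{P}(Y=y)$ is the probability of class $y$ in $\mathcal{D}_{train}$, and $\pi_y=\mathbb{P}(Y=y)$ is the training prior of class $y$. Inverse sampling (the UniMix Sampler, with parameter $\tau$) draws a sample of class $y_i$ with probability $$\mathbb{P}_{inv}(Y=y_i)=\frac{\mathbb{P}^\tau(Y=y_i)}{\int_1^C\mathbb{P}^\tau(Y=y_j)\,dy_j}.$$ The value $\tau=1$ gives the random sampler, while $\tau<1$ means that the sample has higher probability of being drawn from a tail class. Let $f(\cdot;\alpha,\alpha)$ be the density of $Beta(\alpha,\alpha)$. For priors $\pi_{y_i},\pi_{y_j}$ put $c=\frac{\pi_{y_j}}{\pi_{y_i}+\pi_{y_j}}$. The density $\mathscr{U}(\pi_{y_i},\pi_{y_j},\alpha,\alpha)$ of the UniMix Factor on $[0,1]$ takes the value $f(\xi^*_{i,j}-c+1;\alpha,\alpha)$ for $\xi^*_{i,j}\in[0,c)$ and $f(\xi^*_{i,j}-c;\alpha,\alpha)$ for $\xi^*_{i,j}\in[c,1]$. The mixed samples are $\tilde x_{i,j}=\xi^*_{i,j}x_i+(1-\xi^*_{i,j})x_j$, $\tilde y_{i,j}=\xi^*_{i,j}y_i+(1-\xi^*_{i,j})y_j$. A virtual sample mixed in this way with factor $\xi$ is called a $\xi$-Aug sample; it is a (robust) sample of class $y_i$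 iff $\xi\ge0.5$ and of class $y_j$ iff $\xi<0.5$, meaning that it contributes to that class in the model's feature learning. For the random UniMix Factor, whether $\tilde x_{i,j}$ counts as a sample of class $y_i$ is decided by whether the mean of $\xi^*_{i,j}$ is at least $0.5$. $\mathbb{P}_{UniMix}(Y^*=y_i)$ is the probability that $\tilde x_{i,j}$ belongs to class $y_i$. $\mathbf{1}(\cdot)$ is the indicator of a condition. "Tail-majority" means that adequate data concentrates on the tail classes (those with index near $C$); this is read off from the formula being a gently increasing function of $y_i$ in the range $[1,C]$.
   Formalization: Takes ρ>1 and τ≠0 (else 0/0); at α=1 only pairs with y_j<y_i are counted; tail-majority, read as strictly increasing on [1,C], fails for some τ (e.g. τ=1, ρ=100) and is shown to hold exactly when 1+τ≤ρ^τ (τ<0) or ρ^τ≤1+τ (τ>0). *)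

theory Defs
  imports "HOL-Probability.Probability"
begin

text \<open>
  Class indices are real numbers in \<open>[1,C]\<close>, and \<open>P y\<close> is the probability density of class \<open>y\<close>
  in the training set, so the prior of class \<open>y\<close> is \<open>P y\<close>. Only the values of \<open>P\<close> on \<open>[1,C]\<close>
  matter.
\<close>

definition class_law :: "nat \<Rightarrow> (real \<Rightarrow> real) \<Rightarrow> real measure" where
  "class_law C p = density lborel (\<lambda>y. ennreal (p y) * indicator {1..real C} y)"

definition inv_prob :: "nat \<Rightarrow> (real \<Rightarrow> real) \<Rightarrow> real \<Rightarrow> real \<Rightarrow> real" where
  "inv_prob C P \<tau> y = P y powr \<tau> / (LINT t:{1..real C}|lborel. P t powr \<tau>)"

definition beta_density :: "real \<Rightarrow> real \<Rightarrow> real \<Rightarrow> real" where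
  "beta_density a b x =
     (if 0 \<le> x \<and> x \<le> 1 then x powr (a - 1) * (1 - x) powr (b - 1) / Beta a b else 0)"

definition unimix_density :: "real \<Rightarrow> real \<Rightarrow> real \<Rightarrow> real \<Rightarrow> real" where
  "unimix_density \<pi>\<^sub>i \<pi>\<^sub>j \<alpha> \<xi> =
     (let c = \<pi>\<^sub>j / (\<pi>\<^sub>i + \<pi>\<^sub>j) in
      if \<xi> \<in> {0..<c} then beta_density \<alpha> \<alpha> (\<xi> - c + 1)
      else if \<xi> \<in> {c..1} then beta_density \<alpha> \<alpha> (\<xi> - c)
      else 0)"

text \<open>
  The law of the UniMix Factor. For \<open>\<alpha> > 0\<close> it has density \<^const>\<open>unimix_density\<close>, that is, it is
  the law of \<open>frac (X + c)\<close> with \<open>X\<close> distributed as \<open>Beta(\<alpha>,\<alpha>)\<close>. \<open>Beta(0,0)\<close> has no density; as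
  usual it is taken to be the weak limit of \<open>Beta(\<alpha>,\<alpha>)\<close> for \<open>\<alpha> \<rightarrow> 0\<close>, the fair coin on \<open>{0,1}\<close>,
  translated by \<open>c\<close> modulo 1 in the same way.
\<close>

definition unimix_factor :: "real \<Rightarrow> real \<Rightarrow> real \<Rightarrow> real measure" where
  "unimix_factor \<pi>\<^sub>i \<pi>\<^sub>j \<alpha> =
     (if \<alpha> > 0 then density lborel (\<lambda>\<xi>. ennreal (unimix_density \<pi>\<^sub>i \<pi>\<^sub>j \<alpha> \<xi>))
      else distr (measure_pmf (pmf_of_set {0, 1})) borel (\<lambda>x. frac (x + \<pi>\<^sub>j / (\<pi>\<^sub>i + \<pi>\<^sub>j))))"

definition unimix_mean :: "real \<Rightarrow> real \<Rightarrow> real \<Rightarrow> real" where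
  "unimix_mean \<pi>\<^sub>i \<pi>\<^sub>j \<alpha> = (LINT \<xi>|unimix_factor \<pi>\<^sub>i \<pi>\<^sub>j \<alpha>. \<xi>)"

text \<open>
  The distribution of the class \<open>y\<^sub>i\<close> of the first component over those pairs \<open>(y\<^sub>i, y\<^sub>j)\<close> in \<open>R\<close>
  whose mixed sample is a sample of class \<open>y\<^sub>i\<close>; \<open>y\<^sub>i\<close> is drawn randomly and \<open>y\<^sub>j\<close> independently by
  inverse sampling. Mixed samples that belong to the class of the second component are not
  counted, so the total mass is in general less than 1.
\<close>

definition unimix_law ::
    "nat \<Rightarrow> (real \<Rightarrow> real) \<Rightarrow> real \<Rightarrow> real \<Rightarrow> (real \<times> real) set \<Rightarrow> real measure" where
  "unimix_law C P \<tau> \<alpha> R =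
     distr
       (density (class_law C P \<Otimes>\<^sub>M class_law C (inv_prob C P \<tau>))
          (indicator {(y\<^sub>i, y\<^sub>j) \<in> R. y\<^sub>i \<in> {1..real C} \<and> y\<^sub>j \<in> {1..real C} \<and>
             unimix_mean (P y\<^sub>i) (P y\<^sub>j) \<alpha> \<ge> 1 / 2}))
       borel fst"

definition tail_majority :: "nat \<Rightarrow> (real \<Rightarrow> real) \<Rightarrow> bool" where
  "tail_majority C p \<longleftrightarrow> strict_mono_on {1..real C} p"

end

theory Submission
  imports Defs
begin

text \<open>
  Translating a symmetric law with mean \<open>1/2\<close> and distribution function \<open>F\<close> by \<open>c\<close> modulo 1 gives
  the mean \<open>1/2 + c - F(c)\<close>. For \<open>0 < \<alpha> \<le> 1\<close> the density of \<open>Beta(\<alpha>,\<alpha>)\<close> is decreasing on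
  \<open>(0,1/2]\<close>, so \<open>F(c) \<ge> c\<close> for \<open>c \<le> 1/2\<close> and, by symmetry, \<open>F(c) \<le> c\<close> for \<open>c \<ge> 1/2\<close>;
  for \<open>\<alpha> = 0\<close> the mean is \<open>c\<close> itself. Since
  \<open>c \<ge> 1/2\<close> means \<open>\<pi>\<^sub>j \<ge> \<pi>\<^sub>i\<close>, that is \<open>y\<^sub>j \<le> y\<^sub>i\<close>, the indicator equals 1 on the whole domain of
  integration, and the formula is an integral of an exponential. Its derivative has the sign of a
  strictly decreasing function of \<open>y\<^sub>i\<close>, so monotonicity is decided at \<open>y\<^sub>i = C\<close>.
\<close>

section \<open>Symmetric Beta densities and their distribution function\<close>

lemma borel_measurable_beta_density [measurable]: "beta_density a b \<in> borel_measurable borel"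
  unfolding beta_density_def by measurable

lemma beta_density_nonneg: "a > 0 \<Longrightarrow> b > 0 \<Longrightarrow> 0 \<le> beta_density a b x"
  for a b :: real
  by (simp add: beta_density_def Beta_def Gamma_real_nonneg)

lemma beta_density_symmetric: "beta_density a a (1 - x) = beta_density a a x"
  by (simp add: beta_density_def mult.commute)

lemma has_bochner_integral_beta_density:
  assumes "a > 0" "b > 0"
  shows "has_bochner_integral lborel (beta_density a b) 1"
proof -
  have B: "Beta a b > 0"
    using assms by (simp add: Beta_def Gamma_real_pos)
  have "((\<lambda>t. t powr (a - 1) * (1 - t) powr (b - 1) / Beta a b) has_integral Beta a b / Beta a b) {0..1}"
    by (intro has_integral_divide has_integral_Beta_real assms)
  then have "((\<lambda>t. if t \<in> {0..1} then t powr (a - 1) * (1 - t) powr (b - 1) / Beta a b else 0)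
      has_integral 1) UNIV"
    using B by (subst has_integral_restrict_UNIV) simp
  then have "(beta_density a b has_integral 1) UNIV"
    by (simp add: beta_density_def [abs_def])
  then have "(\<integral>\<^sup>+x. beta_density a b x \<partial>lborel) = ennreal 1"
    by (intro nn_integral_has_integral_lborel) (simp_all add: beta_density_nonneg assms)
  then show ?thesis
    by (intro has_bochner_integral_nn_integral) (simp_all add: beta_density_nonneg assms)
qed

lemma integrable_beta_density [simp]: "a > 0 \<Longrightarrow> b > 0 \<Longrightarrow> integrable lborel (beta_density a b)"
  by (rule has_bochner_integral_beta_density[THEN integrable.intros])

lemma integral_beta_density [simp]: "a > 0 \<Longrightarrow> b > 0 \<Longrightarrow> integral\<^sup>L lborel (beta_density a b) = 1"
  by (rule has_bochner_integral_beta_density[THEN has_bochner_integral_integral_eq])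

lemma set_integrable_beta_density:
  assumes "a > 0" "b > 0" "A \<in> sets borel"
  shows "set_integrable lborel A (beta_density a b)"
  using assms unfolding set_integrable_def by (intro integrable_mult_indicator) simp_all

lemma set_integral_beta_density_reflect:
  "(LINT x:{1-s..1}|lborel. beta_density a a x) = (LINT x:{0..s}|lborel. beta_density a a x)"
  unfolding set_lebesgue_integral_def
  by (subst lborel_integral_real_affine[where c = "-1" and t = 1])
     (auto intro!: Bochner_Integration.integral_cong simp: beta_density_symmetric split: split_indicator)

text \<open>The interval \<open>{0..s}\<close> and the reflection of \<open>{0..1-s}\<close> cover
  the unit interval, which carries the whole mass 1, and meet only in the null set
  \<open>{s}\<close>.\<close>

lemma set_integral_beta_density_complement:
  assumes "a > 0" "0 \<le> s" "s \<le> 1"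
  shows "(LINT x:{0..s}|lborel. beta_density a a x) = 1 - (LINT x:{0..1-s}|lborel. beta_density a a x)"
proof -
  have "1 = (LINT x|lborel. beta_density a a x)"
    using assms by simp
  \<comment> \<open>The endpoint \<open>s\<close> is written as \<open>1-(1-s)\<close> to match the
    reflection lemma.\<close>
  also have "\<dots> = (LINT x|lborel. indicator {0..s} x * beta_density a a x
      + indicator {1-(1-s)..1} x * beta_density a a x)"
  proof (intro integral_cong_AE)
    show "AE x in lborel. beta_density a a x
        = indicator {0..s} x * beta_density a a x + indicator {1-(1-s)..1} x * beta_density a a x"
      using AE_lborel_singleton[of s]
      by eventually_elim (use assms in \<open>auto simp: beta_density_def split: split_indicator\<close>)
  qed simp_all
  also have "\<dots> = (LINT x:{0..s}|lborel. beta_density a a x)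
      + (LINT x:{1-(1-s)..1}|lborel. beta_density a a x)"
    unfolding set_lebesgue_integral_def real_scaleR_def
    using assms set_integrable_beta_density[of a a "{0..s}"] set_integrable_beta_density[of a a "{s..1}"]
    by (subst Bochner_Integration.integral_add) (simp_all add: set_integrable_def)
  finally show ?thesis
    unfolding set_integral_beta_density_reflect by simp
qed

text \<open>With equal parameters the density is a constant times the power \<open>a - 1\<close> of
  \<open>z * (1 - z)\<close>. This base increases up to \<open>1/2\<close>, and the exponent is
  nonpositive, negative for \<open>a < 1\<close>.\<close>

lemma beta_density_antimono:
  assumes "0 < a" "a \<le> 1" "0 < x" "x \<le> y" "y \<le> 1/2"
  shows "beta_density a a y \<le> beta_density a a x"
    and "a < 1 \<Longrightarrow> x < y \<Longrightarrow> beta_density a a y < beta_density a a x"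
proof -
  have B: "Beta a a > 0"
    using assms by (simp add: Beta_def Gamma_real_pos)
  have eq: "beta_density a a z = (z * (1 - z)) powr (a - 1) / Beta a a" if "0 < z" "z \<le> 1/2" for z
    using that by (simp add: beta_density_def powr_mult)
  have diff: "y * (1 - y) - x * (1 - x) = (y - x) * (1 - x - y)"
    by (simp add: algebra_simps)
  have "0 \<le> (y - x) * (1 - x - y)"
    using assms by (intro mult_nonneg_nonneg) auto
  with diff have le: "x * (1 - x) \<le> y * (1 - y)" by linarith
  have pos: "0 < x * (1 - x)"
    using assms by simp
  show "beta_density a a y \<le> beta_density a a x"
    using assms le pos B by (simp add: eq divide_right_mono powr_mono2')
  assume "a < 1" "x < y"
  then have "0 < (y - x) * (1 - x - y)"
    using assms by (intro mult_pos_pos) auto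
  with diff have "x * (1 - x) < y * (1 - y)" by linarith
  then show "beta_density a a y < beta_density a a x"
    using assms \<open>a < 1\<close> pos B by (simp add: eq divide_strict_right_mono powr_less_mono2_neg)
qed

text \<open>Comparison with the constant value at an endpoint. The left endpoint is excluded because
  \<open>0 powr _\<close> is 0, so \<open>beta_density\<close> vanishes at 0 and is not decreasing
  there. This lets the lower bound start at \<open>s = 0\<close>; the upper bound evaluates the
  density at \<open>s\<close> and requires \<open>0 < s\<close>.\<close>

lemma set_integral_beta_density_bounds:
  assumes "0 < a" "a \<le> 1" "0 \<le> s" "s \<le> t" "t \<le> 1/2" "0 < t"
  shows "(t - s) * beta_density a a t \<le> (LINT x:{s<..t}|lborel. beta_density a a x)"
    and "0 < s \<Longrightarrow> (LINT x:{s<..t}|lborel. beta_density a a x) \<le> (t - s) * beta_density a a s"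
proof -
  have const: "(LINT x:{s<..t}|lborel. k) = (t - s) * k" "set_integrable lborel {s<..t} (\<lambda>x. k)" for k :: real
    using assms by (auto simp: set_lebesgue_integral_def set_integrable_def)
  show "(t - s) * beta_density a a t \<le> (LINT x:{s<..t}|lborel. beta_density a a x)"
    unfolding const(1)[symmetric] using assms
    by (intro set_integral_mono const set_integrable_beta_density) (auto intro!: beta_density_antimono)
  show "0 < s \<Longrightarrow> (LINT x:{s<..t}|lborel. beta_density a a x) \<le> (t - s) * beta_density a a s"
    unfolding const(1)[symmetric] using assms
    by (intro set_integral_mono const set_integrable_beta_density) (auto intro!: beta_density_antimono)
qed

lemma set_integral_beta_density_split:
  assumes "a > 0" "0 \<le> s" "s \<le> t"
  shows "(LINT x:{0..t}|lborel. beta_density a a x)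
    = (LINT x:{0..s}|lborel. beta_density a a x) + (LINT x:{s<..t}|lborel. beta_density a a x)"
proof -
  have "{0..t} = {0..s} \<union> {s<..t}"
    using assms by auto
  then show ?thesis
    using assms by (simp only:) (intro set_integral_Un set_integrable_beta_density; auto)
qed

lemma beta_cdf_ge:
  assumes "0 < a" "a \<le> 1" "0 < s" "s \<le> 1/2"
  defines "F \<equiv> \<lambda>t. LINT x:{0..t}|lborel. beta_density a a x"
  shows "s \<le> F s" and "a < 1 \<Longrightarrow> s < 1/2 \<Longrightarrow> s < F s"
proof -
  let ?f = "beta_density a a"
  have half: "F (1/2) = 1/2"
    using set_integral_beta_density_complement[of a "1/2"] assms by (simp add: F_def)
  have zero: "F 0 = 0"
    unfolding F_def set_lebesgue_integral_def real_scaleR_def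
    by (intro integral_eq_zero_AE eventually_mono[OF AE_lborel_singleton[of 0]])
       (simp split: split_indicator)
  have split: "F t = F r + (LINT x:{r<..t}|lborel. ?f x)" if "0 \<le> r" "r \<le> t" for r t
    unfolding F_def using that assms by (intro set_integral_beta_density_split) auto
  text \<open>
    The average of the density over \<open>(0,s]\<close> is at least its value at \<open>s\<close>, which is at least its
    average over \<open>(s,1/2]\<close>. Splitting at \<open>s/2\<close> makes the first inequality strict for \<open>a < 1\<close>.
  \<close>
  have low: "F s \<ge> s/2 * ?f (s/2) + s/2 * ?f s"
    using split[of 0 "s/2"] split[of "s/2" s] zero
      set_integral_beta_density_bounds(1)[of a 0 "s/2"] set_integral_beta_density_bounds(1)[of a "s/2" s] assms
    by simp
  have up: "1/2 - F s \<le> (1/2 - s) * ?f s"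
    using split[of s "1/2"] half set_integral_beta_density_bounds(2)[of a s "1/2"] assms
    by simp
  \<comment> \<open>The weights \<open>1/2 - s\<close> and \<open>s\<close> make \<open>?f s\<close>
    cancel; the two terms then get their signs from \<open>low\<close> and
    \<open>up\<close>.\<close>
  have *: "(F s - s) / 2 = (1/2 - s) * (F s - s * ?f s) + s * ((1/2 - s) * ?f s - (1/2 - F s))"
    by (simp add: field_simps)
  have "s/2 * ?f s \<le> s/2 * ?f (s/2)"
    using assms by (intro mult_left_mono beta_density_antimono) auto
  with low have "0 \<le> F s - s * ?f s" by (simp add: field_simps)
  then have "0 \<le> (F s - s) / 2"
    unfolding * using assms up by (intro add_nonneg_nonneg mult_nonneg_nonneg) auto
  then show "s \<le> F s" by simp
  assume "a < 1" "s < 1/2"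
  have "s/2 * ?f s < s/2 * ?f (s/2)"
    using assms \<open>a < 1\<close> by (intro mult_strict_left_mono beta_density_antimono) auto
  with low have "0 < F s - s * ?f s" by (simp add: field_simps)
  then have "0 < (F s - s) / 2"
    unfolding * using assms up \<open>s < 1/2\<close> by (intro add_pos_nonneg mult_nonneg_nonneg mult_pos_pos) auto
  then show "s < F s" by simp
qed

section \<open>Mean of the UniMix Factor\<close>

lemma integral_id_beta_density:
  assumes "a > 0"
  shows "integrable lborel (\<lambda>x. x * beta_density a a x)"
    and "(LINT x|lborel. x * beta_density a a x) = 1/2"
proof -
  show i: "integrable lborel (\<lambda>x. x * beta_density a a x)"
  proof (rule Bochner_Integration.integrable_bound)
    show "integrable lborel (beta_density a a)" using assms by simp
    show "AE x in lborel. norm (x * beta_density a a x) \<le> norm (beta_density a a x)"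
      by (auto simp: beta_density_def abs_mult intro!: AE_I2 divide_right_mono mult_left_le_one_le)
  qed simp
  \<comment> \<open>By reflection the mean equals 1 minus itself.\<close>
  have "(LINT x|lborel. x * beta_density a a x) = (LINT x|lborel. (1 - x) * beta_density a a x)"
    by (subst lborel_integral_real_affine[where c = "-1" and t = 1])
       (simp_all add: beta_density_symmetric)
  also have "\<dots> = 1 - (LINT x|lborel. x * beta_density a a x)"
    using assms i by (simp add: left_diff_distrib)
  finally show "(LINT x|lborel. x * beta_density a a x) = 1/2" by simp
qed

text \<open>With \<open>X\<close> of Beta law the factor is \<open>X + c\<close>, reduced by 1 when
  \<open>X\<close> is at least \<open>1 - c\<close> (up to null sets). Its mean is therefore
  \<open>1/2 + c\<close> minus the mass of \<open>{1-c..1}\<close>, and by reflection this mass is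
  that of \<open>{0..c}\<close>.\<close>

lemma unimix_mean_eq:
  assumes "a > 0" "0 < p" "0 < q"
  defines "c \<equiv> q / (p + q)"
  shows "unimix_mean p q a = 1/2 + c - (LINT x:{0..c}|lborel. beta_density a a x)"
proof -
  let ?f = "beta_density a a"
  have c: "0 < c" "c < 1"
    using assms by (simp_all add: c_def field_simps)
  define g where "g = (\<lambda>\<xi>. indicator {0..<c} \<xi> * ?f (\<xi> - c + 1))"
  define h where "h = (\<lambda>\<xi>. indicator {c..1} \<xi> * ?f (\<xi> - c))"
  have [measurable]: "g \<in> borel_measurable borel" "h \<in> borel_measurable borel"
    unfolding g_def h_def by measurable
  have U: "unimix_density p q a \<xi> = g \<xi> + h \<xi>" for \<xi>
    unfolding unimix_density_def Let_def c_def[symmetric] g_def h_def by (auto split: split_indicator)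
  have nonneg: "0 \<le> g \<xi> + h \<xi>" for \<xi>
    unfolding g_def h_def using assms by (simp add: beta_density_nonneg)
  have int_ind: "integrable lborel (\<lambda>x. indicator A x * ?f x)" if "A \<in> sets borel" for A
    using set_integrable_beta_density[of a a A] assms that by (simp add: set_integrable_def)
  have int_ind_id: "integrable lborel (\<lambda>x. indicator A x * (x * ?f x))" if "A \<in> sets borel" for A
    using integrable_mult_indicator[of A lborel "\<lambda>x. x * ?f x"] integral_id_beta_density(1)[OF assms(1)] that by simp
  \<comment> \<open>These are the integrands \<open>\<xi> * g \<xi>\<close> and
    \<open>\<xi> * h \<xi>\<close> in the untranslated variable, where \<open>\<xi>\<close> is
    \<open>x + c - 1\<close> on the first branch and \<open>x + c\<close> on the second.\<close>
  define g' where "g' = (\<lambda>x. indicator {1-c..<1} x * (x * ?f x) + (c - 1) * (indicator {1-c..<1} x * ?f x))"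
  define h' where "h' = (\<lambda>x. indicator {0..1-c} x * (x * ?f x) + c * (indicator {0..1-c} x * ?f x))"
  have int': "integrable lborel g'" "integrable lborel h'"
    unfolding g'_def h'_def using int_ind int_ind_id by simp_all
  have g: "g' (1 - c + 1 * \<xi>) = \<xi> * g \<xi>" for \<xi>
    unfolding g'_def g_def by (auto split: split_indicator simp: algebra_simps)
  have h: "h' (- c + 1 * \<xi>) = \<xi> * h \<xi>" for \<xi>
    unfolding h'_def h_def by (auto split: split_indicator simp: algebra_simps)
  have int: "integrable lborel (\<lambda>\<xi>. \<xi> * g \<xi>)" "integrable lborel (\<lambda>\<xi>. \<xi> * h \<xi>)"
    using lborel_integrable_real_affine[OF int'(1), of 1 "1 - c"] lborel_integrable_real_affine[OF int'(2), of 1 "-c"]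
    unfolding g h by simp_all
  have "unimix_mean p q a = (LINT \<xi>|lborel. \<xi> * g \<xi> + \<xi> * h \<xi>)"
    unfolding unimix_mean_def unimix_factor_def using assms(1) nonneg
    by (simp add: U integral_real_density algebra_simps)
  also have "\<dots> = integral\<^sup>L lborel g' + integral\<^sup>L lborel h'"
    using int lborel_integral_real_affine[of 1 g' "1 - c"] lborel_integral_real_affine[of 1 h' "- c"]
    unfolding g h by simp
  also have "\<dots> = (LINT x|lborel. g' x + h' x)"
    using int' by simp
  also have "\<dots> = (LINT x|lborel. (x * ?f x + c * ?f x) - indicator {1-c..1} x * ?f x)"
  proof (intro integral_cong_AE)
    \<comment> \<open>The exceptional points are \<open>1 - c\<close>, which both branches count,
      and \<open>1\<close>, which \<open>g'\<close> omits.\<close>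
    show "AE x in lborel. g' x + h' x = (x * ?f x + c * ?f x) - indicator {1-c..1} x * ?f x"
      using AE_lborel_singleton[of "1::real"] AE_lborel_singleton[of "1-c"]
    proof eventually_elim
      case (elim x)
      have "?f x = 0" if "x < 0 \<or> x > 1"
        using that by (auto simp: beta_density_def)
      with elim c show ?case
        unfolding g'_def h'_def
        by (cases "x < 0 \<or> x > 1"; cases "x < 1 - c") (auto simp: algebra_simps split: split_indicator)
    qed
  qed (simp_all add: g'_def h'_def)
  also have "\<dots> = (LINT x|lborel. x * ?f x) + c * integral\<^sup>L lborel ?f - (LINT x:{1-c..1}|lborel. ?f x)"
    using int_ind[of "{1-c..1}"] integral_id_beta_density(1)[OF assms(1)] assms(1)
    by (simp add: set_lebesgue_integral_def)
  finally show ?thesis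
    using assms(1) by (simp add: integral_id_beta_density set_integral_beta_density_reflect)
qed

text \<open>Both atoms 0 and 1 of the fair coin are moved to the same point \<open>c\<close> modulo
  1, so the factor is constant.\<close>

lemma unimix_mean_0:
  assumes "0 < p" "0 < q"
  shows "unimix_mean p q 0 = q / (p + q)"
proof -
  define c where "c = q / (p + q)"
  have c: "0 \<le> c" "c < 1"
    using assms by (simp_all add: c_def field_simps)
  then have "frac c = c" "frac (1 + c) = c"
    using frac_1_eq[of c] by (simp_all add: frac_eq add.commute[of 1])
  then show ?thesis
    unfolding unimix_mean_def unimix_factor_def c_def[symmetric]
    by (simp add: integral_distr integral_pmf_of_set)
qed

lemma unimix_mean_ge_half:
  assumes "0 \<le> a" "a \<le> 1" "0 < p" "p \<le> q"
  shows "1/2 \<le> unimix_mean p q a"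
proof -
  define c where "c = q / (p + q)"
  have c: "1/2 \<le> c" "c < 1"
    using assms by (simp_all add: c_def field_simps)
  show ?thesis
  proof (cases "a = 0")
    case True
    with assms c show ?thesis by (simp add: unimix_mean_0 flip: c_def)
  next
    case False
    \<comment> \<open>Since \<open>beta_cdf_ge\<close> covers only arguments up to
      \<open>1/2\<close>, the complement passes from \<open>c\<close> to
      \<open>1 - c\<close>.\<close>
    then have "unimix_mean p q a = 1/2 + c - (1 - (LINT x:{0..1-c}|lborel. beta_density a a x))"
      using assms c set_integral_beta_density_complement[of a c] by (simp add: unimix_mean_eq flip: c_def)
    then show ?thesis
      using beta_cdf_ge(1)[of a "1 - c"] assms c False by simp
  qed
qed

text \<open>Here \<open>a = 1\<close> has to be excluded: the Beta law is then uniform, so is its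
  translate modulo 1, and the mean is \<open>1/2\<close> whatever the priors are.\<close>

lemma unimix_mean_less_half:
  assumes "0 \<le> a" "a < 1" "0 < q" "q < p"
  shows "unimix_mean p q a < 1/2"
proof -
  define c where "c = q / (p + q)"
  have c: "0 < c" "c < 1/2"
    using assms by (simp_all add: c_def field_simps)
  show ?thesis
  proof (cases "a = 0")
    case True
    with assms c show ?thesis by (simp add: unimix_mean_0 flip: c_def)
  next
    case False
    then show ?thesis
      using beta_cdf_ge(2)[of a c] assms c by (simp add: unimix_mean_eq flip: c_def)
  qed
qed

section \<open>First marginal of a product law restricted to a set, by Tonelli\<close>

lemma distr_fst_density_pair:
  fixes u v :: "real \<Rightarrow> ennreal" and S :: "(real \<times> real) set"
  assumes [measurable]: "u \<in> borel_measurable borel" "v \<in> borel_measurable borel" "S \<in> sets (borel \<Otimes>\<^sub>M borel)"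
    and fin: "\<And>y. v y \<noteq> \<infinity>"
  shows "distr (density (density lborel u \<Otimes>\<^sub>M density lborel v) (indicator S)) borel fst
    = density lborel (\<lambda>x. u x * (\<integral>\<^sup>+y. v y * indicator S (x, y) \<partial>lborel))"
proof -
  \<comment> \<open>Finite values of \<open>v\<close> give the sigma-finiteness that the product of
    densities requires.\<close>
  have "sigma_finite_measure (density lborel v)"
    using fin by (subst sigma_finite_measure.sigma_finite_iff_density_finite[OF sigma_finite_lborel]) auto
  then have pair: "density lborel u \<Otimes>\<^sub>M density lborel v = density (lborel \<Otimes>\<^sub>M lborel) (\<lambda>(x, y). u x * v y)"
    by (intro pair_measure_density) (auto intro: sigma_finite_lborel)
  have [measurable]: "S \<in> sets (lborel \<Otimes>\<^sub>M lborel)"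
    using assms(3) by (simp cong: sets_pair_measure_cong)
  show ?thesis
    unfolding pair
  proof (rule measure_eqI)
    fix A assume "A \<in> sets (distr (density (density (lborel \<Otimes>\<^sub>M lborel) (\<lambda>(x, y). u x * v y)) (indicator S)) borel fst)"
    then have [measurable]: "A \<in> sets borel" by simp
    have "emeasure (distr (density (density (lborel \<Otimes>\<^sub>M lborel) (\<lambda>(x, y). u x * v y)) (indicator S)) borel fst) A
      = (\<integral>\<^sup>+z. (case z of (x, y) \<Rightarrow> u x * v y) * indicator S z * indicator A (fst z) \<partial>(lborel \<Otimes>\<^sub>M lborel))"
      by (subst nn_integral_indicator[symmetric])
         (simp_all add: nn_integral_distr nn_integral_density mult.assoc del: nn_integral_indicator)
    also have "\<dots> = (\<integral>\<^sup>+x. \<integral>\<^sup>+y. u x * v y * indicator S (x, y) * indicator A x \<partial>lborel \<partial>lborel)"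
      by (subst lborel.nn_integral_fst[symmetric]) (simp_all add: split_beta')
    also have "\<dots> = (\<integral>\<^sup>+x. (u x * (\<integral>\<^sup>+y. v y * indicator S (x, y) \<partial>lborel)) * indicator A x \<partial>lborel)"
      by (intro nn_integral_cong) (simp add: nn_integral_cmult[symmetric] nn_integral_multc[symmetric] mult_ac)
    also have "\<dots> = emeasure (density lborel (\<lambda>x. u x * (\<integral>\<^sup>+y. v y * indicator S (x, y) \<partial>lborel))) A"
      by (subst emeasure_density) simp_all
    finally show "emeasure (distr (density (density (lborel \<Otimes>\<^sub>M lborel) (\<lambda>(x, y). u x * v y)) (indicator S)) borel fst) A
      = emeasure (density lborel (\<lambda>x. u x * (\<integral>\<^sup>+y. v y * indicator S (x, y) \<partial>lborel))) A" .
  qed simp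
qed

section \<open>Integrals and monotonicity of exponential expressions\<close>

lemma has_bochner_integral_exp_Icc:
  fixes k s t :: real
  assumes "k \<noteq> 0" "s \<le> t"
  shows "has_bochner_integral lborel (\<lambda>x. exp (- k * x) * indicator {s..t} x) ((exp (- k * s) - exp (- k * t)) / k)"
proof -
  have "has_bochner_integral lborel (\<lambda>x. exp (- k * x) * indicator {s..t} x)
      (- exp (- k * t) / k - (- exp (- k * s) / k))"
    using assms
    by (intro has_bochner_integral_FTC_Icc_real)
       (auto intro!: derivative_eq_intros continuous_intros)
  then show ?thesis
    using assms(1) by (simp add: diff_divide_distrib)
qed

lemma set_integral_exp_Icc:
  fixes k s t :: real
  assumes "k \<noteq> 0" "s \<le> t"
  shows "(LINT x:{s..t}|lborel. exp (- k * x)) = (exp (- k * s) - exp (- k * t)) / k"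
  using has_bochner_integral_integral_eq[OF has_bochner_integral_exp_Icc[OF assms]]
  by (simp add: set_lebesgue_integral_def mult.commute)

text \<open>Up to a positive factor this is the density of the mixed classes. The sign
  \<open>- sgn \<tau>\<close> makes it nonnegative on \<open>{1..L}\<close> for either sign of
  \<open>\<tau>\<close>, so both cases share one argument.\<close>

lemma strict_mono_on_exp_diff_iff:
  fixes l \<tau> L :: real
  assumes "l > 0" "\<tau> \<noteq> 0" "L > 1"
  shows "strict_mono_on {1..L} (\<lambda>y. - sgn \<tau> * (exp (- l * y * (\<tau> + 1)) - exp (- l * (\<tau> + y))))
    \<longleftrightarrow> sgn \<tau> * exp (l * \<tau> * (L - 1)) \<le> sgn \<tau> * (1 + \<tau>)"
    (is "strict_mono_on _ ?g \<longleftrightarrow> ?R")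
proof -
  \<comment> \<open>\<open>d\<close> carries the sign of the derivative; the right-hand side of the
    equivalence says \<open>d L \<ge> 0\<close>.\<close>
  define d where "d = (\<lambda>y. sgn \<tau> * (1 + \<tau>) - sgn \<tau> * exp (l * \<tau> * (y - 1)))"
  have deriv: "(?g has_real_derivative l * exp (- l * y * (\<tau> + 1)) * d y) (at y)" for y
    unfolding d_def
    by (auto intro!: derivative_eq_intros simp: algebra_simps mult_exp_exp)
  have d_less: "d z < d y" if "y < z" for y z
  proof (cases "\<tau> > 0")
    case True
    then show ?thesis using assms that by (simp add: d_def)
  next
    case False
    then have "\<tau> < 0" using assms by simp
    then have "l * \<tau> < 0" using assms by (simp add: mult_pos_neg)
    then show ?thesis using \<open>\<tau> < 0\<close> that by (simp add: d_def mult_less_cancel_left)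
  qed
  have cont: "continuous_on A ?g" for A
    by (intro continuous_intros)
  show ?thesis
  proof
    assume ?R
    then have "d L \<ge> 0" by (simp add: d_def)
    then have pos: "0 < l * exp (- l * y * (\<tau> + 1)) * d y" if "y < L" for y
      using d_less[OF that] assms(1) by simp
    show "strict_mono_on {1..L} ?g"
    proof (rule strict_mono_onI)
      fix r s assume "r \<in> {1..L}" "s \<in> {1..L}" "r < s"
      then show "?g r < ?g s"
        using deriv pos
        \<comment> \<open>If \<open>d L = 0\<close>, the derivative vanishes at \<open>L\<close>,
          hence the criterion on the open interval.\<close>
        by (intro DERIV_pos_imp_increasing_open[of r s ?g]) (force intro!: cont)+
    qed
  next
    assume mono: "strict_mono_on {1..L} ?g"
    show ?R
    proof (rule ccontr)
      assume "\<not> ?R"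
      then have "d L < 0" by (simp add: d_def)
      then have "l * exp (- l * L * (\<tau> + 1)) * d L < 0"
        using assms(1) by (simp add: mult_pos_neg)
      from DERIV_neg_dec_left[OF deriv this] obtain \<delta> where
        \<delta>: "\<delta> > 0" "\<And>h. 0 < h \<Longrightarrow> h < \<delta> \<Longrightarrow> ?g L < ?g (L - h)"
        by blast
      \<comment> \<open>The bound \<open>L - 1\<close> keeps \<open>L - h\<close> inside
        \<open>{1..L}\<close>, where the larger value at \<open>L - h\<close> contradicts
        monotonicity.\<close>
      define h where "h = min (\<delta> / 2) (L - 1)"
      have "0 < h" "h < \<delta>" "h \<le> L - 1"
        using \<delta> assms(3) by (auto simp: h_def)
      then show False
        using strict_mono_onD[OF mono, of "L - h" L] \<delta>(2)[of h] by simp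
    qed
  qed
qed

lemma AE_Icc_iff_Ico: "AE y in lborel. y \<in> {s..t} \<longleftrightarrow> y \<in> {s..<t}" for s t :: real
  using AE_lborel_singleton[of t] by eventually_elim auto

section \<open>The law of the mixed classes for exponentially decaying priors\<close>

theorem corollary3:
  fixes C :: nat and \<rho> lam \<tau> \<alpha> :: real and P :: "real \<Rightarrow> real"
  assumes "C \<ge> 2" and "\<rho> > 1"
    and "lam = ln \<rho> / (real C - 1)"
    and "\<And>y. y \<in> {1..real C} \<Longrightarrow> P y = lam / (exp (- lam) - exp (- lam * real C)) * exp (- lam * y)"
    and "\<tau> \<noteq> 0"
    and "\<alpha> \<in> {0..1}"
  shows "let P_UniMix = (\<lambda>y\<^sub>i. P y\<^sub>i * (LINT y\<^sub>j:{1..<y\<^sub>i}|lborel.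
                 of_bool (unimix_mean (P y\<^sub>i) (P y\<^sub>j) \<alpha> \<ge> 1 / 2) * inv_prob C P \<tau> y\<^sub>j))
    in unimix_law C P \<tau> \<alpha> {(y\<^sub>i, y\<^sub>j). y\<^sub>j < y\<^sub>i} = class_law C P_UniMix
     \<and> (\<alpha> < 1 \<longrightarrow> unimix_law C P \<tau> \<alpha> UNIV = class_law C P_UniMix)
     \<and> (\<forall>y\<^sub>i \<in> {1..real C}. P_UniMix y\<^sub>i =
          lam / ((exp (- lam) - exp (- lam * real C)) * (exp (- lam * \<tau> * real C) - exp (- lam * \<tau>)))
            * (exp (- lam * y\<^sub>i * (\<tau> + 1)) - exp (- lam * (\<tau> + y\<^sub>i))))
     \<and> (tail_majority C P_UniMix \<longleftrightarrow>
          (if \<tau> < 0 then 1 + \<tau> \<le> \<rho> powr \<tau> else \<rho> powr \<tau> \<le> 1 + \<tau>))"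
proof -
  define L where "L = real C"
  define K where "K = lam / (exp (- lam) - exp (- lam * L))"
  define Z where "Z = (exp (- lam * \<tau>) - exp (- lam * \<tau> * L)) / (lam * \<tau>)"
  \<comment> \<open>\<open>P\<close> is arbitrary outside \<open>{1..L}\<close>, possibly not even
    measurable. \<open>p\<close> and \<open>q\<close> are continuous functions on the whole line
    that agree there with \<open>P\<close> and \<open>inv_prob C P \<tau>\<close>; \<open>Z\<close>
    is the integral of \<open>exp (- (lam * \<tau>) * y)\<close> over \<open>{1..L}\<close>.\<close>
  define p where "p = (\<lambda>y. K * exp (- lam * y))"
  define q where "q = (\<lambda>y. exp (- (lam * \<tau>) * y) / Z)"
  define Q where "Q = (\<lambda>y\<^sub>i. P y\<^sub>i * (LINT y\<^sub>j:{1..<y\<^sub>i}|lborel.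
                 of_bool (unimix_mean (P y\<^sub>i) (P y\<^sub>j) \<alpha> \<ge> 1 / 2) * inv_prob C P \<tau> y\<^sub>j))"
  have L: "L > 1" using assms(1) by (simp add: L_def)
  have lam: "lam > 0" using assms(2,3) L by (simp add: L_def)
  have lt: "lam * \<tau> \<noteq> 0" using lam assms(5) by simp
  have K: "K > 0" using lam L by (simp add: K_def)
  have Z: "Z > 0"
  proof (cases "\<tau> > 0")
    case True
    then show ?thesis using lam L by (simp add: Z_def mult_pos_pos)
  next
    case False
    then have "lam * \<tau> < 0" using lam assms(5) by (simp add: mult_pos_neg)
    then have "lam * \<tau> * L < lam * \<tau>"
      using L mult_strict_left_mono_neg[of 1 L "lam * \<tau>"] by simp
    with \<open>lam * \<tau> < 0\<close> show ?thesis unfolding Z_def by (intro divide_neg_neg) auto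
  qed
  have P: "P y = p y" if "y \<in> {1..L}" for y
    using assms(4) that by (simp add: L_def K_def p_def)
  have p: "0 < p y" for y using K by (simp add: p_def)
  have q: "0 < q y" for y using Z by (simp add: q_def)
  have p_less: "p y < p z \<longleftrightarrow> z < y" and p_le: "p y \<le> p z \<longleftrightarrow> z \<le> y" for y z
    using K lam by (simp_all add: p_def)
  have [measurable]: "p \<in> borel_measurable borel" "q \<in> borel_measurable borel"
    by (simp_all add: p_def q_def)

  \<comment> \<open>The factor \<open>K powr \<tau>\<close> cancels between numerator and
    normalising integral of \<open>inv_prob\<close>.\<close>
  have powr_p: "p y powr \<tau> = K powr \<tau> * exp (- (lam * \<tau>) * y)" for y
    using K by (simp add: p_def powr_mult exp_powr_real mult_ac)
  have "(LINT t:{1..L}|lborel. P t powr \<tau>) = (LINT t:{1..L}|lborel. K powr \<tau> * exp (- (lam * \<tau>) * t))"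
    by (intro set_lebesgue_integral_cong) (auto simp: P powr_p)
  also have "\<dots> = K powr \<tau> * Z"
    using set_integral_exp_Icc[OF lt, of 1 L] L by (simp add: Z_def)
  finally have inv: "inv_prob C P \<tau> y = q y" if "y \<in> {1..L}" for y
    using that K by (simp add: inv_prob_def P powr_p q_def flip: L_def)

  have mean: "unimix_mean (P x) (P y) \<alpha> \<ge> 1/2" if "x \<in> {1..L}" "y \<in> {1..L}" "y \<le> x" for x y
    using that assms(6) p unimix_mean_ge_half[of \<alpha> "p x" "p y"] by (simp add: P p_le)
  have mean': "unimix_mean (P x) (P y) \<alpha> < 1/2"
    if "\<alpha> < 1" "x \<in> {1..L}" "y \<in> {1..L}" "x < y" for x y
    using that assms(6) p unimix_mean_less_half[of \<alpha> "p y" "p x"] by (simp add: P p_less)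

  have int_q: "(LINT y:{1..x}|lborel. q y) = (exp (- lam * \<tau>) - exp (- lam * \<tau> * x)) / (lam * \<tau> * Z)"
    if "1 \<le> x" for x
    using set_integral_exp_Icc[OF lt that] by (simp add: q_def)
  have set_q: "set_integrable lborel {1..x} q" for x
    unfolding q_def by (intro borel_integrable_atLeastAtMost' continuous_intros) (use Z in auto)
  have inner: "(LINT y:{1..<x}|lborel. of_bool (unimix_mean (P x) (P y) \<alpha> \<ge> 1/2) * inv_prob C P \<tau> y)
      = (LINT y:{1..x}|lborel. q y)" if x: "x \<in> {1..L}" for x
  proof -
    have "(LINT y:{1..<x}|lborel. of_bool (unimix_mean (P x) (P y) \<alpha> \<ge> 1/2) * inv_prob C P \<tau> y)
        = (LINT y:{1..<x}|lborel. q y)"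
      using x mean by (intro set_lebesgue_integral_cong) (auto simp: inv)
    also have "\<dots> = (LINT y:{1..x}|lborel. q y)"
      using AE_Icc_iff_Ico[of 1 x]
      by (intro set_integral_cong_set) (auto simp: set_borel_measurable_def)
    finally show ?thesis .
  qed
  have Q: "Q x = p x * (LINT y:{1..x}|lborel. q y)" if "x \<in> {1..L}" for x
    unfolding Q_def inner[OF that] using P[OF that] by simp

  \<comment> \<open>Each slice of the diagonal is a null set, so \<open>S\<close> is prescribed only
    off it. This treats the strict and the non-strict triangle at once.\<close>
  have law: "distr (density (class_law C P \<Otimes>\<^sub>M class_law C (inv_prob C P \<tau>)) (indicator S)) borel fst
      = class_law C Q"
    if S: "S \<in> sets (borel \<Otimes>\<^sub>M borel)" "\<And>x y. y \<noteq> x \<Longrightarrow> (x, y) \<in> S \<longleftrightarrow> x \<in> {1..L} \<and> 1 \<le> y \<and> y < x" for S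
  proof -
    let ?u = "\<lambda>y. ennreal (p y) * indicator {1..L} y" and ?v = "\<lambda>y. ennreal (q y) * indicator {1..L} y"
    have u: "class_law C P = density lborel ?u"
      unfolding class_law_def L_def[symmetric]
      by (rule arg_cong[where f = "density lborel"]) (auto simp: P fun_eq_iff split: split_indicator)
    have v: "class_law C (inv_prob C P \<tau>) = density lborel ?v"
      unfolding class_law_def L_def[symmetric]
      by (rule arg_cong[where f = "density lborel"]) (auto simp: inv fun_eq_iff split: split_indicator)
    have "?u x * (\<integral>\<^sup>+y. ?v y * indicator S (x, y) \<partial>lborel) = ennreal (Q x) * indicator {1..L} x" for x
    proof (cases "x \<in> {1..L}")
      case True
      have "(\<integral>\<^sup>+y. ?v y * indicator S (x, y) \<partial>lborel) = (\<integral>\<^sup>+y. ennreal (indicator {1..x} y * q y) \<partial>lborel)"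
        using AE_lborel_singleton[of x]
        by (intro nn_integral_cong_AE, eventually_elim)
           (use True in \<open>auto simp: S(2) split: split_indicator\<close>)
      also have "\<dots> = ennreal (LINT y:{1..x}|lborel. q y)"
        unfolding set_lebesgue_integral_def real_scaleR_def using set_q[of x] q
        by (intro nn_integral_eq_integral) (auto simp: set_integrable_def less_imp_le)
      finally show ?thesis
        using True p[of x] by (simp add: Q ennreal_mult' less_imp_le)
    qed simp
    then show ?thesis
      unfolding u v
      by (subst distr_fst_density_pair)
         (use S(1) in \<open>auto simp: class_law_def L_def ennreal_mult_eq_top_iff split: split_indicator\<close>)
  qed

  have law_less: "unimix_law C P \<tau> \<alpha> {(y\<^sub>i, y\<^sub>j). y\<^sub>j < y\<^sub>i} = class_law C Q"
  proof -
    \<comment> \<open>The mean condition holds throughout the triangle. Dropping it removes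
      \<open>P\<close> from the set and leaves order conditions that are clearly measurable.\<close>
    have eq: "{(y\<^sub>i, y\<^sub>j) \<in> {(y\<^sub>i, y\<^sub>j). y\<^sub>j < y\<^sub>i}. y\<^sub>i \<in> {1..L} \<and> y\<^sub>j \<in> {1..L} \<and> unimix_mean (P y\<^sub>i) (P y\<^sub>j) \<alpha> \<ge> 1 / 2}
        = {z. snd z < fst z \<and> fst z \<in> {1..L} \<and> snd z \<in> {1..L}}"
      (is "_ = ?S")
      by (auto simp: mean simp del: divide_le_eq_numeral1)
    have "{z \<in> space (borel \<Otimes>\<^sub>M borel). snd z < fst z \<and> fst z \<in> {1..L} \<and> snd z \<in> {1..L}}
        \<in> sets (borel \<Otimes>\<^sub>M borel)"
      unfolding atLeastAtMost_iff by measurable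
    then have "?S \<in> sets (borel \<Otimes>\<^sub>M borel)"
      by (simp only: space_pair_measure space_borel UNIV_Times_UNIV UNIV_I simp_thms)
    then have "distr (density (class_law C P \<Otimes>\<^sub>M class_law C (inv_prob C P \<tau>)) (indicator ?S)) borel fst
        = class_law C Q"
      by (rule law) auto
    then show ?thesis
      by (simp only: unimix_law_def eq flip: L_def)
  qed
  \<comment> \<open>For \<open>\<alpha> < 1\<close> the mean condition is equivalent to
    \<open>y\<^sub>j \<le> y\<^sub>i\<close>, so it cuts out the triangle, now with its diagonal, by
    itself.\<close>
  have law_all: "unimix_law C P \<tau> \<alpha> UNIV = class_law C Q" if "\<alpha> < 1"
  proof -
    have eq: "{(y\<^sub>i, y\<^sub>j) \<in> UNIV. y\<^sub>i \<in> {1..L} \<and> y\<^sub>j \<in> {1..L} \<and> unimix_mean (P y\<^sub>i) (P y\<^sub>j) \<alpha> \<ge> 1 / 2}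
        = {z. snd z \<le> fst z \<and> fst z \<in> {1..L} \<and> snd z \<in> {1..L}}"
      (is "_ = ?S")
    proof -
      have "unimix_mean (P x) (P y) \<alpha> \<ge> 1/2 \<longleftrightarrow> y \<le> x" if "x \<in> {1..L}" "y \<in> {1..L}" for x y
        using mean[of x y] mean'[OF \<open>\<alpha> < 1\<close>, of x y] that by (meson not_le)
      then show ?thesis
        by (auto simp del: divide_le_eq_numeral1)
    qed
    have "{z \<in> space (borel \<Otimes>\<^sub>M borel). snd z \<le> fst z \<and> fst z \<in> {1..L} \<and> snd z \<in> {1..L}}
        \<in> sets (borel \<Otimes>\<^sub>M borel)"
      unfolding atLeastAtMost_iff by measurable
    then have "?S \<in> sets (borel \<Otimes>\<^sub>M borel)"
      by (simp only: space_pair_measure space_borel UNIV_Times_UNIV UNIV_I simp_thms)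
    then have "distr (density (class_law C P \<Otimes>\<^sub>M class_law C (inv_prob C P \<tau>)) (indicator ?S)) borel fst
        = class_law C Q"
      by (rule law) auto
    then show ?thesis
      by (simp only: unimix_law_def eq flip: L_def)
  qed

  have formula: "Q y = lam / ((exp (- lam) - exp (- lam * L)) * (exp (- lam * \<tau> * L) - exp (- lam * \<tau>)))
            * (exp (- lam * y * (\<tau> + 1)) - exp (- lam * (\<tau> + y)))" if "y \<in> {1..L}" for y
  proof -
    have "lam * \<tau> * Z = exp (- lam * \<tau>) - exp (- lam * \<tau> * L)"
      using lt by (simp add: Z_def)
    then have "Q y = K * exp (- lam * y) * ((exp (- lam * \<tau>) - exp (- lam * \<tau> * y)) / (exp (- lam * \<tau>) - exp (- lam * \<tau> * L)))"
      unfolding Q[OF that] p_def using that int_q[of y] by simp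
    also have "\<dots> = K * (exp (- lam * y) * (exp (- lam * \<tau> * y) - exp (- lam * \<tau>)) / (exp (- lam * \<tau> * L) - exp (- lam * \<tau>)))"
    proof -
      have "(exp (- lam * \<tau>) - exp (- lam * \<tau> * y)) / (exp (- lam * \<tau>) - exp (- lam * \<tau> * L))
          = (exp (- lam * \<tau> * y) - exp (- lam * \<tau>)) / (exp (- lam * \<tau> * L) - exp (- lam * \<tau>))"
        by (metis minus_diff_eq minus_divide_divide)
      then show ?thesis
        by (simp only: mult.assoc times_divide_eq_right)
    qed
    also have "exp (- lam * y) * (exp (- lam * \<tau> * y) - exp (- lam * \<tau>)) = exp (- lam * y * (\<tau> + 1)) - exp (- lam * (\<tau> + y))"
      by (simp add: algebra_simps mult_exp_exp)
    finally show ?thesis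
      by (simp add: K_def)
  qed

  \<comment> \<open>The denominator is \<open>- (lam * \<tau> * Z)\<close>. Its sign is split off as
    \<open>- sgn \<tau>\<close>, leaving a positive factor that does not affect strict
    monotonicity.\<close>
  define A where "A = K / (\<bar>lam * \<tau>\<bar> * Z)"
  have A: "A > 0" using K Z lt by (simp add: A_def)
  have "Q y = A * (- sgn \<tau> * (exp (- lam * y * (\<tau> + 1)) - exp (- lam * (\<tau> + y))))" if "y \<in> {1..L}" for y
  proof -
    have "exp (- lam * \<tau> * L) - exp (- lam * \<tau>) = - (lam * \<tau> * Z)"
      using lt by (simp add: Z_def)
    then have "Q y = K / (- (lam * \<tau> * Z)) * (exp (- lam * y * (\<tau> + 1)) - exp (- lam * (\<tau> + y)))"
      using formula[OF that] by (simp add: K_def)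
    moreover have "K / (- (lam * \<tau> * Z)) = A * (- sgn \<tau>)"
      using lam assms(5) by (cases "\<tau> > 0") (simp_all add: A_def abs_mult)
    ultimately show ?thesis by (simp only: mult.assoc)
  qed
  then have Q_scaled: "Q r < Q s \<longleftrightarrow>
      - sgn \<tau> * (exp (- lam * r * (\<tau> + 1)) - exp (- lam * (\<tau> + r)))
      < - sgn \<tau> * (exp (- lam * s * (\<tau> + 1)) - exp (- lam * (\<tau> + s)))"
    if "r \<in> {1..L}" "s \<in> {1..L}" for r s
    using that A by (simp only: mult_less_cancel_left_pos)
  have "strict_mono_on {1..L} Q
      \<longleftrightarrow> strict_mono_on {1..L} (\<lambda>y. - sgn \<tau> * (exp (- lam * y * (\<tau> + 1)) - exp (- lam * (\<tau> + y))))"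
    unfolding strict_mono_on_def using Q_scaled by blast
  also have "\<dots> \<longleftrightarrow> sgn \<tau> * exp (lam * \<tau> * (L - 1)) \<le> sgn \<tau> * (1 + \<tau>)"
    by (rule strict_mono_on_exp_diff_iff[OF lam assms(5) L])
  \<comment> \<open>By the choice of \<open>lam\<close>, \<open>lam * (L - 1)\<close> is
    \<open>ln \<rho>\<close>.\<close>
  also have "exp (lam * \<tau> * (L - 1)) = \<rho> powr \<tau>"
    using assms(2,3) L by (simp add: powr_def L_def)
  finally have tail: "tail_majority C Q \<longleftrightarrow> (if \<tau> < 0 then 1 + \<tau> \<le> \<rho> powr \<tau> else \<rho> powr \<tau> \<le> 1 + \<tau>)"
    using assms(5) unfolding tail_majority_def L_def by (cases "\<tau> < 0") auto
  show ?thesis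
    unfolding Let_def L_def[symmetric] Q_def[symmetric]
    by (intro conjI impI ballI law_less law_all formula tail)
qed

end
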